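(* Let $\alpha>0$. There exists $t_0>e$ such that the function $\Theta:[t_0,\infty)\to(0,\infty)$ defined by $\Theta(t)=\dfrac{1}{(\log\log t)^{\alpha}}$ satisfies the following properties: (a) $\Theta(t)\to 0$ as $t\to\infty$; (b) $t\mapsto \Theta(t)\log t$ is strictly increasing; (c) $\Theta(t)\log t\to\infty$ as $t\to\infty$; (d) $\Theta(t^2)/\Theta(t)\to 1$ as $t\to\infty$; (e) for every $0<\beta<1$, $(\log t)^{\beta\,\Theta(\log t)}\,\Theta(t)\to\infty$ as $t\to\infty$.
   Context: All logarithms are natural; $\log\log t=\log(\log t)$. *)

theory Defs
  imports Complex_Main
begin

text \<open>
  A total function on the reals; it is only meaningful where \<open>ln (ln t) > 0\<close>, that is for
  \<open>t > exp 1\<close>, since \<open>powr\<close> is real exponentiation for positive bases only.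
\<close>

definition Theta :: "real \<Rightarrow> real \<Rightarrow> real" where
  "Theta \<alpha> t = 1 / (ln (ln t) powr \<alpha>)"

end

theory Submission
  imports Defs "HOL-Real_Asymp.Real_Asymp"
begin

text \<open>Put s = log log t. Then \<open>Theta \<alpha> t * ln t\<close> is exp(s) / s^\<alpha>,
  whose logarithm s - \<alpha> log s has slope 1 - \<alpha>/s, positive once s > \<alpha>; this is
  \<open>strict_mono_on_exp_div_powr\<close> and gives (b). The other limits compare growth rates:
  in (c) the exponential beats the power; in (d) squaring t only replaces s by s + log 2; in (e) the
  logarithm of the expression is \<beta> s / (log s)^\<alpha> - \<alpha> log s, where the first term
  dominates.\<close>

lemma strict_mono_on_exp_div_powr:
  fixes \<alpha> :: real
  assumes "\<alpha> > 0"
  shows "strict_mono_on {\<alpha><..} (\<lambda>s. exp s / s powr \<alpha>)"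
proof (rule strict_mono_onI)
  fix r s :: real
  assume "r \<in> {\<alpha><..}" "s \<in> {\<alpha><..}" and "r < s"
  with assms have pos: "r > 0" "s > 0" and "\<alpha> < r" by auto
  \<comment> \<open>Concavity replaces differentiation: \<open>ln\<close> lies below its tangent at
    r, and r > \<alpha> makes the resulting slope \<alpha>/r less than 1.\<close>
  have "\<alpha> * (ln s - ln r) \<le> \<alpha> * ((s - r) / r)"
    using assms pos by (intro mult_left_mono ln_diff_le) auto
  also have "\<dots> = \<alpha> / r * (s - r)" by simp
  also have "\<dots> < 1 * (s - r)"
    using \<open>\<alpha> < r\<close> pos \<open>r < s\<close> by (intro mult_strict_right_mono) auto
  finally have "exp (r - \<alpha> * ln r) < exp (s - \<alpha> * ln s)"
    by (simp add: algebra_simps)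
  then show "exp r / r powr \<alpha> < exp s / s powr \<alpha>"
    using pos by (simp add: exp_diff powr_def)
qed

theorem proposition13p1:
  fixes \<alpha> :: real
  assumes "\<alpha> > 0"
  shows "\<exists>t0 > exp (1::real).
           (\<forall>t \<ge> t0. Theta \<alpha> t > 0) \<and>
           (Theta \<alpha> \<longlongrightarrow> 0) at_top \<and>
           strict_mono_on {t0..} (\<lambda>t. Theta \<alpha> t * ln t) \<and>
           filterlim (\<lambda>t. Theta \<alpha> t * ln t) at_top at_top \<and>
           ((\<lambda>t. Theta \<alpha> (t\<^sup>2) / Theta \<alpha> t) \<longlongrightarrow> 1) at_top \<and>
           (\<forall>\<beta>::real. 0 < \<beta> \<and> \<beta> < 1 \<longrightarrow>
              filterlim (\<lambda>t. (ln t) powr (\<beta> * Theta \<alpha> (ln t)) * Theta \<alpha> t) at_top at_top)"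
\<comment> \<open>This threshold forces log log t \<ge> \<alpha> + 1, strictly inside the range s >
  \<alpha> of the monotonicity lemma.\<close>
proof (intro exI[of _ "exp (exp (\<alpha> + 1))"] conjI allI impI)
  have loglog: "1 < t \<and> 0 < ln t \<and> \<alpha> < ln (ln t)" if "t \<ge> exp (exp (\<alpha> + 1))" for t :: real
  proof -
    have "t > 1"
      using that by (smt (verit) exp_gt_zero one_less_exp_iff)
    then have "exp (\<alpha> + 1) \<le> ln t"
      using that by (simp add: ln_ge_iff)
    then have "ln t > 0" and "\<alpha> + 1 \<le> ln (ln t)"
      using \<open>t > 1\<close> by (simp_all add: ln_ge_iff)
    with \<open>t > 1\<close> show ?thesis by simp
  qed
  show "exp 1 < exp (exp (\<alpha> + 1))"
    using assms by simp
  show "Theta \<alpha> t > 0" if "t \<ge> exp (exp (\<alpha> + 1))" for t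
    using loglog[OF that] assms by (auto simp: Theta_def)
  show "(Theta \<alpha> \<longlongrightarrow> 0) at_top"
    unfolding Theta_def using assms by real_asymp
  show "strict_mono_on {exp (exp (\<alpha> + 1))..} (\<lambda>t. Theta \<alpha> t * ln t)"
  proof (rule strict_mono_onI)
    fix x y :: real
    assume "x \<in> {exp (exp (\<alpha> + 1))..}" "y \<in> {exp (exp (\<alpha> + 1))..}" and "x < y"
    with loglog[of x] loglog[of y]
    \<comment> \<open>Since \<open>ln x\<close> and \<open>ln y\<close> are positive, the numerators
      collapse to them, which recovers \<open>Theta \<alpha> t * ln t\<close> at both
      points.\<close>
    have "exp (ln (ln x)) / ln (ln x) powr \<alpha> < exp (ln (ln y)) / ln (ln y) powr \<alpha>"
      by (intro strict_mono_onD[OF strict_mono_on_exp_div_powr[OF assms]]) auto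
    with loglog[of x] loglog[of y] \<open>x \<in> _\<close> \<open>y \<in> _\<close>
    show "Theta \<alpha> x * ln x < Theta \<alpha> y * ln y"
      by (simp add: Theta_def)
  qed
  show "filterlim (\<lambda>t. Theta \<alpha> t * ln t) at_top at_top"
    unfolding Theta_def using assms by real_asymp
  show "((\<lambda>t. Theta \<alpha> (t\<^sup>2) / Theta \<alpha> t) \<longlongrightarrow> 1) at_top"
    unfolding Theta_def using assms by real_asymp
  show "filterlim (\<lambda>t. (ln t) powr (\<beta> * Theta \<alpha> (ln t)) * Theta \<alpha> t) at_top at_top"
    if "0 < \<beta> \<and> \<beta> < 1" for \<beta>
  proof -
    \<comment> \<open>The sign of \<beta> decides that the dominant term \<beta> s / (log
      s)^\<alpha> tends to plus infinity.\<close>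
    from that have "\<beta> > 0" by simp
    then show ?thesis
      unfolding Theta_def using assms by real_asymp
  qed
qed

end
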